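(* Let $\{\beta_N\}_{N\in\mathbb{N}}\subset(0,1)$ and $\{\epsilon_N\}_{N\in\mathbb{N}}\subset(0,\infty)$ be sequences such that $\sum_{N=1}^\infty\beta_N<\infty$, $\lim_{N\to\infty}\epsilon_N=0$, and $\mathbb{P}^N\big(W_1(\mathbb{P},\widehat{\mathbb{P}}_N)\le\epsilon_N\big)\ge 1-\beta_N$ for each $N\in\mathbb{N}$. Assume that $F:\mathbb{R}^n\times\Xi\to\mathbb{R}$ is uniformly continuous and that either of the following holds: (a) $\mathbb{P}(\{\xi\in\Xi\mid F(x,\xi)=0\})=0$ for all $x\in X$; (b) the set-valued map $H(x):=\{\xi\in\Xi\mid F(x,\xi)\le0\}$ is convex-valued and continuous over $X$ (where continuity means inner and outer semicontinuity of the set-valued map), and for any $x\in X$, $\mathbb{P}(\mathrm{bd}\,H(x))=0$, where $\mathrm{bd}\,H(x)$ denotes the boundary of the set $H(x)$. Consider the chance-constrained program (CCP) $$\min_{x\in X}\ c^\intercal x\quad\text{s.t.}\quad\mathbb{P}(F(x,\xi)\le0)\ge1-\alpha,$$ and, for each $N$, the distributionally robust chance-constrained program (DRCCP$_N$) $$\min_{x\in X}\ c^\intercal x\quad\text{s.t.}\quad\inf_{\mathbb{Q}\in\mathcal{M}_N^{\epsilon_N}}\mathbb{Q}(F(x,\xi)\le0)\ge1-\alpha.$$ Let $\mathsf{J}^{\mathtt{CCP}}$ be the optimal value of CCP, and let $\mathsf{J}^{\mathtt{DRCCP}}_N$ and $x^{\mathtt{DRCCP}}_N$ be the optimal value and an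 optimizer of DRCCP$_N$, respectively. Assume that there exists a compact set $\mathcal{Y}\subset X$ such that the optimizers of CCP belong to $\mathcal{Y}$. Suppose there exists an optimizer $x^*$ of CCP that belongs to the closure of the set $\{x\in X\mid\mathbb{P}(F(x,\xi)\le0)>1-\alpha\}$. Moreover, assume that for sufficiently large $N$ and any sequence of i.i.d. samples $\{\widehat{\xi}_i\}_{i=1}^N$, the optimizers of DRCCP$_N$ belong to $\mathcal{Y}$. Then the following statements hold $\mathbb{P}^\infty$-almost surely: (i) $\mathsf{J}^{\mathtt{CCP}}\le\mathsf{J}^{\mathtt{DRCCP}}_N$ for all sufficiently large $N$; (ii) $\mathsf{J}^{\mathtt{DRCCP}}_N\to\mathsf{J}^{\mathtt{CCP}}$ as $N\to\infty$; (iii) any accumulation point of any sequence of optimizers $\{x^{\mathtt{DRCCP}}_N\}_{N\in\mathbb{N}}$ is an optimizer of CCP.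
   Context: Setting: $\Xi\subseteq\mathbb{R}^m$ and $d$ is a complete metric on $\Xi$. $X\subseteq\mathbb{R}^n$ is a closed convex set, $c\in\mathbb{R}^n$, $\alpha\in(0,1)$. $\mathcal{P}_1(\Xi)$ is the set of Borel probability measures on $\Xi$ with finite first moment, and $\mathbb{P}\in\mathcal{P}_1(\Xi)$ is the distribution of the uncertain parameter $\xi$. Wasserstein distance: for $\mu,\nu\in\mathcal{P}_1(\Xi)$, $W_1(\mu,\nu):=\min_{\gamma\in\mathcal{H}(\mu,\nu)}\int_{\Xi\times\Xi}d(\xi,\omega)\,\gamma(d\xi,d\omega)$, where $\mathcal{H}(\mu,\nu)$ is the set of probability measures on $\Xi\times\Xi$ with marginals $\mu$ and $\nu$. Samples and ambiguity sets: $\widehat{\xi}_1,\widehat{\xi}_2,\dots$ are drawn independently from $\mathbb{P}$; $\mathbb{P}^N$ and $\mathbb{P}^\infty$ are the $N$-fold and infinite product measures governing the samples. $\widehat{\mathbb{P}}_N:=\frac1N\sum_{i=1}^N\delta_{\widehat{\xi}_i}$ is the empirical distribution ($\delta_{\widehat\xi_i}$ is the unit point mass at $\widehat\xi_i$), and for $\theta\ge0$, $\mathcal{M}_N^\theta:=\{\mu\in\mathcal{P}_1(\Xi)\mid W_1(\mu,\widehat{\mathbb{P}}_N)\le\theta\}$. Thus DRCCP$_N$ is a random optimization problem. *)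

theory Defs
  imports "HOL-Probability.Probability"
begin

text \<open>
  A metric space \<open>(\<Xi>, d)\<close> is given as \<open>D :: 'a metric\<close> with \<open>\<Xi> = mspace D\<close> and \<open>d = mdist D\<close>;
  topological and measure-theoretic notions on \<open>\<Xi>\<close> refer to the topology of \<open>d\<close>.
\<close>

definition borel_of_topology :: "'a topology \<Rightarrow> 'a measure" where
  "borel_of_topology T = sigma (topspace T) {U. openin T U}"

definition metric_borel :: "'a metric \<Rightarrow> 'a measure" where
  "metric_borel D = borel_of_topology (mtopology_of D)"

lemma space_metric_borel [simp]: "space (metric_borel D) = mspace D"
  by (simp add: metric_borel_def borel_of_topology_def space_measure_of_conv)

definition P1 :: "'a metric \<Rightarrow> 'a measure set" where
  "P1 D = {\<mu>. prob_space \<mu> \<and> sets \<mu> = sets (metric_borel D) \<and>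
               (\<exists>\<xi>0\<in>mspace D. integrable \<mu> (\<lambda>\<xi>. mdist D \<xi>0 \<xi>))}"

text \<open>
  Couplings live on the Borel sets of the product topology. For separable \<open>D\<close> this is the product
  sigma-algebra; in general only the former is guaranteed to make the distance measurable.
\<close>

definition couplings :: "'a metric \<Rightarrow> 'a measure \<Rightarrow> 'a measure \<Rightarrow> ('a \<times> 'a) measure set" where
  "couplings D \<mu> \<nu> =
     {\<gamma>. prob_space \<gamma> \<and>
          sets \<gamma> = sets (borel_of_topology (prod_topology (mtopology_of D) (mtopology_of D))) \<and>
          distr \<gamma> (metric_borel D) fst = \<mu> \<and> distr \<gamma> (metric_borel D) snd = \<nu>}"

definition wasserstein1 :: "'a metric \<Rightarrow> 'a measure \<Rightarrow> 'a measure \<Rightarrow> ennreal" where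
  "wasserstein1 D \<mu> \<nu> =
     (INF \<gamma>\<in>couplings D \<mu> \<nu>. \<integral>\<^sup>+ z. ennreal (mdist D (fst z) (snd z)) \<partial>\<gamma>)"

definition empirical :: "'a metric \<Rightarrow> nat \<Rightarrow> (nat \<Rightarrow> 'a) \<Rightarrow> 'a measure" where
  "empirical D N \<omega> =
     measure_of (mspace D) (sets (metric_borel D))
       (\<lambda>A. (\<Sum>i=1..N. emeasure (return (metric_borel D) (\<omega> i)) A) / of_nat N)"

lemma sets_empirical [simp]: "sets (empirical D N \<omega>) = sets (metric_borel D)"
  using sets.sigma_sets_eq[of "metric_borel D"] sets.space_closed[of "metric_borel D"]
  by (simp add: empirical_def)

lemma emeasure_empirical:
  assumes "A \<in> sets (metric_borel D)"
  shows "emeasure (empirical D N \<omega>) A =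
           (\<Sum>i=1..N. emeasure (return (metric_borel D) (\<omega> i)) A) / of_nat N"
proof (rule emeasure_measure_of[OF empirical_def])
  show "sets (metric_borel D) \<subseteq> Pow (mspace D)"
    using sets.space_closed[of "metric_borel D"] by simp
  show "A \<in> sets (empirical D N \<omega>)"
    using assms by simp
  show "positive (sets (empirical D N \<omega>))
          (\<lambda>A. (\<Sum>i=1..N. emeasure (return (metric_borel D) (\<omega> i)) A) / of_nat N)"
    by (simp add: positive_def)
  show "countably_additive (sets (empirical D N \<omega>))
          (\<lambda>A. (\<Sum>i=1..N. emeasure (return (metric_borel D) (\<omega> i)) A) / of_nat N)"
  proof (rule countably_additiveI)
    fix B :: "nat \<Rightarrow> 'a set"
    assume B: "range B \<subseteq> sets (empirical D N \<omega>)" "disjoint_family B"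
    have "(\<Sum>k. emeasure (return (metric_borel D) (\<omega> i)) (B k)) =
            emeasure (return (metric_borel D) (\<omega> i)) (\<Union>k. B k)" for i
      using B by (intro suminf_emeasure) auto
    then show "(\<Sum>k. (\<Sum>i=1..N. emeasure (return (metric_borel D) (\<omega> i)) (B k)) / of_nat N) =
                 (\<Sum>i=1..N. emeasure (return (metric_borel D) (\<omega> i)) (\<Union>k. B k)) / of_nat N"
      by (simp add: divide_ennreal_def ennreal_suminf_multc suminf_sum)
  qed
qed

definition ambiguity_set :: "'a metric \<Rightarrow> nat \<Rightarrow> real \<Rightarrow> (nat \<Rightarrow> 'a) \<Rightarrow> 'a measure set" where
  "ambiguity_set D N \<theta> \<omega> = {\<mu>\<in>P1 D. wasserstein1 D \<mu> (empirical D N \<omega>) \<le> ennreal \<theta>}"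

definition ccp_feasible ::
  "'b set \<Rightarrow> ('b \<Rightarrow> 'a \<Rightarrow> real) \<Rightarrow> real \<Rightarrow> 'a measure \<Rightarrow> 'b set" where
  "ccp_feasible X F \<alpha> P = {x\<in>X. \<P>(\<xi> in P. F x \<xi> \<le> 0) \<ge> 1 - \<alpha>}"

definition drccp_feasible ::
  "'a metric \<Rightarrow> 'b set \<Rightarrow> ('b \<Rightarrow> 'a \<Rightarrow> real) \<Rightarrow> real \<Rightarrow> nat \<Rightarrow> real \<Rightarrow> (nat \<Rightarrow> 'a) \<Rightarrow> 'b set" where
  "drccp_feasible D X F \<alpha> N \<theta> \<omega> =
     {x\<in>X. (INF Q\<in>ambiguity_set D N \<theta> \<omega>. \<P>(\<xi> in Q. F x \<xi> \<le> 0)) \<ge> 1 - \<alpha>}"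

text \<open>The optimal value is extended real, so that an infeasible problem has value \<open>\<infinity>\<close>.\<close>

definition opt_value :: "'b::real_inner \<Rightarrow> 'b set \<Rightarrow> ereal" where
  "opt_value c S = (INF x\<in>S. ereal (c \<bullet> x))"

definition optimizers :: "'b::real_inner \<Rightarrow> 'b set \<Rightarrow> 'b set" where
  "optimizers c S = {x. is_arg_min (\<lambda>x. c \<bullet> x) (\<lambda>x. x \<in> S) x}"

text \<open>
  Painleve--Kuratowski semicontinuity, relative to \<open>X\<close>, of a map into the subsets of \<open>mspace D\<close>:
  the outer limit of \<open>H\<close> at each \<open>x \<in> X\<close> is contained in \<open>H x\<close>, resp.\ the inner limit contains \<open>H x\<close>.
\<close>

definition outer_semicontinuous_on ::
  "'b::topological_space set \<Rightarrow> 'a metric \<Rightarrow> ('b \<Rightarrow> 'a set) \<Rightarrow> bool" where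
  "outer_semicontinuous_on X D H \<longleftrightarrow>
     (\<forall>x\<in>X. \<forall>xs us u. (\<forall>k. xs k \<in> X) \<and> xs \<longlonglongrightarrow> x \<and> (\<forall>k. us k \<in> H (xs k)) \<and>
        limitin (mtopology_of D) us u sequentially \<longrightarrow> u \<in> H x)"

definition inner_semicontinuous_on ::
  "'b::topological_space set \<Rightarrow> 'a metric \<Rightarrow> ('b \<Rightarrow> 'a set) \<Rightarrow> bool" where
  "inner_semicontinuous_on X D H \<longleftrightarrow>
     (\<forall>x\<in>X. \<forall>u\<in>H x. \<forall>xs. (\<forall>k. xs k \<in> X) \<and> xs \<longlonglongrightarrow> x \<longrightarrow>
        (\<exists>us. (\<forall>\<^sub>F k in sequentially. us k \<in> H (xs k)) \<and>
              limitin (mtopology_of D) us u sequentially))"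

end

(*
  The concentration bounds and Borel-Cantelli give, almost surely, W1(P, empirical) <= eps_N for all
  large N; then P itself lies in the ambiguity set, so DRCCP-feasible points are CCP-feasible.
  Conversely, if P(F(x,.) <= 0) > 1 - alpha, either regularity condition yields an open subset U of
  {F(x,.) <= 0} with P(U) > 1 - alpha, and hence a delta such that the points whose
  2 delta-neighbourhood lies in U still have mass above 1 - alpha. By Markov's inequality, passing
  from P through the empirical measure to a member of the ambiguity set costs mass at most
  2 eps_N / delta, so x is eventually DRCCP-feasible. The values along strictly feasible points
  approaching x* squeeze J_N, and optimality passes to accumulation points because the CCP-feasible
  set is closed.
*)
theory Submission
  imports Defs
begin

section \<open>Borel sets of a topology and measurability of continuous maps\<close>

lemma sets_borel_of_topology:
  "sets (borel_of_topology T) = sigma_sets (topspace T) {U. openin T U}"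
  unfolding borel_of_topology_def by (rule sets_measure_of) (auto dest: openin_subset)

lemma space_borel_of_topology: "space (borel_of_topology T) = topspace T"
  by (simp add: borel_of_topology_def space_measure_of_conv)

lemma openin_imp_sets_borel_of_topology: "openin T U \<Longrightarrow> U \<in> sets (borel_of_topology T)"
  by (simp add: sets_borel_of_topology sigma_sets.Basic)

lemma openin_imp_sets_metric_borel: "openin (mtopology_of D) U \<Longrightarrow> U \<in> sets (metric_borel D)"
  by (simp add: metric_borel_def openin_imp_sets_borel_of_topology)

lemma closedin_imp_sets_metric_borel:
  assumes "closedin (mtopology_of D) C"
  shows "C \<in> sets (metric_borel D)"
proof -
  have "mspace D - C \<in> sets (metric_borel D)"
    using assms by (intro openin_imp_sets_metric_borel) (simp add: closedin_def)
  from sets.compl_sets[OF this] show ?thesis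
    using closedin_subset[OF assms] by (simp add: double_diff)
qed

lemma continuous_map_imp_measurable:
  assumes "continuous_map S T f"
  shows "f \<in> borel_of_topology S \<rightarrow>\<^sub>M borel_of_topology T"
  unfolding borel_of_topology_def[of T]
proof (rule measurable_measure_of)
  show "{U. openin T U} \<subseteq> Pow (topspace T)"
    by (auto dest: openin_subset)
  show "f \<in> space (borel_of_topology S) \<rightarrow> topspace T"
    using assms by (simp add: space_borel_of_topology continuous_map_def)
  show "f -` U \<inter> space (borel_of_topology S) \<in> sets (borel_of_topology S)"
    if "U \<in> {U. openin T U}" for U
  proof -
    have "openin S {x \<in> topspace S. f x \<in> U}"
      using assms that by (simp add: openin_continuous_map_preimage)
    moreover have "f -` U \<inter> space (borel_of_topology S) = {x \<in> topspace S. f x \<in> U}"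
      by (auto simp: space_borel_of_topology)
    ultimately show ?thesis
      by (simp add: openin_imp_sets_borel_of_topology)
  qed
qed

lemma borel_of_topology_euclidean: "borel_of_topology euclidean = borel"
  by (simp add: borel_of_topology_def borel_def)

section \<open>Transport inequalities for couplings and the Wasserstein distance\<close>

lemma P1_D:
  assumes "\<mu> \<in> P1 D"
  shows "prob_space \<mu>" "sets \<mu> = sets (metric_borel D)" "space \<mu> = mspace D"
  using assms sets_eq_imp_space_eq[of \<mu> "metric_borel D"] by (auto simp: P1_def)

text \<open>Markov's inequality in a form without division: under \<open>\<gamma>\<close>, mass that
  starts in \<open>A\<close> and does not end in \<open>B\<close> travels at least
  \<open>\<delta>\<close>, and so pays at least \<open>\<delta>\<close> per unit. Both directions
  are stated because \<open>\<mu>\<close> and \<open>\<nu>\<close> sit in fixed coordinates of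
  \<open>\<gamma>\<close>.\<close>

lemma couplings_transport_le:
  fixes D :: "'a metric"
  assumes \<gamma>: "\<gamma> \<in> couplings D \<mu> \<nu>"
    and sets: "A \<in> sets (metric_borel D)" "B \<in> sets (metric_borel D)"
    and near: "\<And>\<xi> \<eta>. \<xi> \<in> A \<Longrightarrow> \<eta> \<in> mspace D \<Longrightarrow> mdist D \<xi> \<eta> < \<delta> \<Longrightarrow> \<eta> \<in> B"
  shows "ennreal \<delta> * emeasure \<mu> A
           \<le> ennreal \<delta> * emeasure \<nu> B + (\<integral>\<^sup>+ z. ennreal (mdist D (fst z) (snd z)) \<partial>\<gamma>)"
    and "ennreal \<delta> * emeasure \<nu> A
           \<le> ennreal \<delta> * emeasure \<mu> B + (\<integral>\<^sup>+ z. ennreal (mdist D (fst z) (snd z)) \<partial>\<gamma>)"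
proof -
  let ?T = "mtopology_of D"
  let ?cost = "\<lambda>z. ennreal (mdist D (fst z) (snd z))"
  have sets_\<gamma>: "sets \<gamma> = sets (borel_of_topology (prod_topology ?T ?T))"
    and marginals: "distr \<gamma> (metric_borel D) fst = \<mu>" "distr \<gamma> (metric_borel D) snd = \<nu>"
    using \<gamma> by (auto simp: couplings_def)
  have space_\<gamma>: "space \<gamma> = mspace D \<times> mspace D"
    using sets_eq_imp_space_eq[OF sets_\<gamma>] by (simp add: space_borel_of_topology)
  \<comment> \<open>\<open>\<gamma>\<close> carries the Borel sets of the product topology, so the
    projections and the distance are measurable because they are continuous.\<close>
  have meas: "f \<in> \<gamma> \<rightarrow>\<^sub>M borel_of_topology T'"
    if "continuous_map (prod_topology ?T ?T) T' f" for f and T' :: "'c topology"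
    using continuous_map_imp_measurable[OF that] by (simp cong: measurable_cong_sets add: sets_\<gamma>)
  have fst_meas [measurable]: "fst \<in> \<gamma> \<rightarrow>\<^sub>M metric_borel D"
    and snd_meas [measurable]: "snd \<in> \<gamma> \<rightarrow>\<^sub>M metric_borel D"
    unfolding metric_borel_def by (intro meas continuous_map_fst continuous_map_snd)+
  have "(\<lambda>z. mdist D (fst z) (snd z)) \<in> \<gamma> \<rightarrow>\<^sub>M borel_of_topology euclideanreal"
    by (intro meas continuous_map_mdist continuous_map_fst continuous_map_snd)
  then have [measurable]: "(\<lambda>z. mdist D (fst z) (snd z)) \<in> borel_measurable \<gamma>"
    by (simp add: borel_of_topology_euclidean)
  have transport: "ennreal \<delta> * emeasure \<gamma> A' \<le> ennreal \<delta> * emeasure \<gamma> B' + (\<integral>\<^sup>+ z. ?cost z \<partial>\<gamma>)"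
    if "A' \<in> sets \<gamma>" "B' \<in> sets \<gamma>"
      and "\<And>z. z \<in> A' \<Longrightarrow> z \<in> space \<gamma> \<Longrightarrow> mdist D (fst z) (snd z) < \<delta> \<Longrightarrow> z \<in> B'" for A' B'
  proof -
    have "ennreal \<delta> * emeasure \<gamma> A' = (\<integral>\<^sup>+ z. ennreal \<delta> * indicator A' z \<partial>\<gamma>)"
      using that(1) by (simp add: nn_integral_cmult_indicator)
    \<comment> \<open>Pointwise: where the distance is below \<open>\<delta>\<close>, a point of
      \<open>A'\<close> lies in \<open>B'\<close>; elsewhere the cost alone is at least
      \<open>\<delta>\<close>.\<close>
    also have "\<dots> \<le> (\<integral>\<^sup>+ z. ennreal \<delta> * indicator B' z + ?cost z \<partial>\<gamma>)"
    proof (rule nn_integral_mono)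
      fix z assume "z \<in> space \<gamma>"
      then show "ennreal \<delta> * indicator A' z \<le> ennreal \<delta> * indicator B' z + ?cost z"
        using that(3)[of z]
        by (cases "mdist D (fst z) (snd z) < \<delta>") (auto intro!: ennreal_leI simp: indicator_def)
    qed
    also have "\<dots> = ennreal \<delta> * emeasure \<gamma> B' + (\<integral>\<^sup>+ z. ?cost z \<partial>\<gamma>)"
      using that(2) by (simp add: nn_integral_add nn_integral_cmult_indicator)
    finally show ?thesis .
  qed
  \<comment> \<open>Masses of both marginals become masses under the one measure
    \<open>\<gamma>\<close>, where \<open>transport\<close> compares them.\<close>
  have marginal: "emeasure \<mu> C = emeasure \<gamma> (fst -` C \<inter> space \<gamma>)"
       "emeasure \<nu> C = emeasure \<gamma> (snd -` C \<inter> space \<gamma>)" if "C \<in> sets (metric_borel D)" for C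
    using that by (auto simp: marginals[symmetric] emeasure_distr fst_meas snd_meas)
  show "ennreal \<delta> * emeasure \<mu> A \<le> ennreal \<delta> * emeasure \<nu> B + (\<integral>\<^sup>+ z. ?cost z \<partial>\<gamma>)"
    unfolding marginal[OF sets(1)] marginal[OF sets(2)] using sets near
    by (intro transport measurable_sets[OF fst_meas] measurable_sets[OF snd_meas])
       (auto simp: space_\<gamma>)
  show "ennreal \<delta> * emeasure \<nu> A \<le> ennreal \<delta> * emeasure \<mu> B + (\<integral>\<^sup>+ z. ?cost z \<partial>\<gamma>)"
    unfolding marginal[OF sets(1)] marginal[OF sets(2)] using sets near
    by (intro transport measurable_sets[OF fst_meas] measurable_sets[OF snd_meas])
       (auto simp: space_\<gamma> mdist_commute)
qed

text \<open>The coupling bound holds for every coupling and hence passes to the infimum, so no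
  optimal coupling has to be exhibited. If there is no coupling, the infimum is
  \<open>\<top>\<close> and the bound is trivial.\<close>

lemma wasserstein1_transport_le:
  assumes sets: "A \<in> sets (metric_borel D)" "B \<in> sets (metric_borel D)"
    and near: "\<And>\<xi> \<eta>. \<xi> \<in> A \<Longrightarrow> \<eta> \<in> mspace D \<Longrightarrow> mdist D \<xi> \<eta> < \<delta> \<Longrightarrow> \<eta> \<in> B"
    and W: "wasserstein1 D \<mu> \<nu> \<le> w"
  shows "ennreal \<delta> * emeasure \<mu> A \<le> ennreal \<delta> * emeasure \<nu> B + w"
    and "ennreal \<delta> * emeasure \<nu> A \<le> ennreal \<delta> * emeasure \<mu> B + w"
proof -
  let ?cost = "\<lambda>\<gamma>. \<integral>\<^sup>+ z. ennreal (mdist D (fst z) (snd z)) \<partial>\<gamma>"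
  have transport: "b \<le> a + w" if "\<And>\<gamma>. \<gamma> \<in> couplings D \<mu> \<nu> \<Longrightarrow> b \<le> a + ?cost \<gamma>" for a b
  proof -
    have "b \<le> a + wasserstein1 D \<mu> \<nu>"
    \<comment> \<open>For finite \<open>a\<close>, subtraction turns the hypothesis into a lower
      bound \<open>b - a\<close> common to all costs.\<close>
    proof (cases "a = \<top>")
      case False
      have "b - a \<le> wasserstein1 D \<mu> \<nu>"
        unfolding wasserstein1_def using that False
        by (intro INF_greatest) (simp add: ennreal_minus_le_iff)
      then show ?thesis
        using False by (simp add: ennreal_minus_le_iff)
    qed simp
    also have "\<dots> \<le> a + w"
      using W by (rule add_left_mono)
    finally show ?thesis .
  qed
  show "ennreal \<delta> * emeasure \<mu> A \<le> ennreal \<delta> * emeasure \<nu> B + w"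
    by (rule transport) (rule couplings_transport_le(1)[OF _ sets near])
  show "ennreal \<delta> * emeasure \<nu> A \<le> ennreal \<delta> * emeasure \<mu> B + w"
    by (rule transport) (rule couplings_transport_le(2)[OF _ sets near])
qed

section \<open>Erosions of a set\<close>

text \<open>The complement of the open \<open>\<delta>\<close>-neighbourhood of
  \<open>mspace D - U\<close>; it is therefore closed, hence Borel.\<close>

definition erosion :: "'a metric \<Rightarrow> 'a set \<Rightarrow> real \<Rightarrow> 'a set" where
  "erosion D U \<delta> = {\<xi>\<in>mspace D. \<forall>\<eta>\<in>mspace D. mdist D \<xi> \<eta> < \<delta> \<longrightarrow> \<eta> \<in> U}"

lemma closedin_erosion: "closedin (mtopology_of D) (erosion D U \<delta>)"
proof -
  interpret Metric_space "mspace D" "mdist D" by (rule Metric_space_mspace_mdist)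
  have "mspace D - erosion D U \<delta> = (\<Union>\<eta>\<in>mspace D - U. mball \<eta> \<delta>)"
    by (auto simp: erosion_def mdist_commute)
  moreover have "openin mtopology (\<Union>\<eta>\<in>mspace D - U. mball \<eta> \<delta>)"
    by (rule openin_Union) auto
  ultimately show ?thesis
    by (simp add: closedin_def mtopology_of_def) (auto simp: erosion_def)
qed

lemma mdist_self: "\<xi> \<in> mspace D \<Longrightarrow> mdist D \<xi> \<xi> = 0"
  by simp

lemma erosion_subset: "\<delta> > 0 \<Longrightarrow> erosion D U \<delta> \<subseteq> U"
  by (force simp: erosion_def mdist_self)

lemma erosion_antimono: "\<delta> \<le> \<delta>' \<Longrightarrow> erosion D U \<delta>' \<subseteq> erosion D U \<delta>"
  by (auto simp: erosion_def)

text \<open>Triangle inequality: a move shorter than \<open>\<delta>\<close> uses up only that part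
  of the margin. This allows one margin to be spent on two successive transports.\<close>

lemma erosion_add_near:
  assumes "\<xi> \<in> erosion D U (\<delta> + \<delta>')" "\<eta> \<in> mspace D" "mdist D \<xi> \<eta> < \<delta>"
  shows "\<eta> \<in> erosion D U \<delta>'"
proof -
  have "\<zeta> \<in> U" if "\<zeta> \<in> mspace D" "mdist D \<eta> \<zeta> < \<delta>'" for \<zeta>
  proof -
    have "mdist D \<xi> \<zeta> \<le> mdist D \<xi> \<eta> + mdist D \<eta> \<zeta>"
      using assms that by (intro mdist_triangle) (auto simp: erosion_def)
    then show ?thesis
      using assms that by (auto simp: erosion_def)
  qed
  then show ?thesis
    using assms(2) by (simp add: erosion_def)
qed

text \<open>Every point of an open set has a ball inside it, and some \<open>inverse (Suc n)\<close>
  is below its radius. Continuity of measure then recovers the mass of \<open>U\<close> from its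
  erosions.\<close>

lemma UN_erosion:
  assumes "openin (mtopology_of D) U"
  shows "(\<Union>n. erosion D U (inverse (Suc n))) = U"
proof
  show "(\<Union>n. erosion D U (inverse (Suc n))) \<subseteq> U"
    using erosion_subset[of "inverse (Suc _)" D U] by force
  show "U \<subseteq> (\<Union>n. erosion D U (inverse (Suc n)))"
  proof
    interpret Metric_space "mspace D" "mdist D" by (rule Metric_space_mspace_mdist)
    fix \<xi> assume "\<xi> \<in> U"
    then obtain r where r: "r > 0" "mball \<xi> r \<subseteq> U" and "\<xi> \<in> mspace D"
      using assms unfolding mtopology_of_def openin_mtopology by blast
    obtain n where "inverse (Suc n) < r"
      using reals_Archimedean[OF r(1)] by blast
    then have "\<xi> \<in> erosion D U (inverse (Suc n))"
      using r(2) \<open>\<xi> \<in> mspace D\<close> by (auto simp: erosion_def subset_iff)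
    then show "\<xi> \<in> (\<Union>n. erosion D U (inverse (Suc n)))" by blast
  qed
qed

section \<open>Comparison of the feasible sets of CCP and DRCCP\<close>

lemma ambiguity_set_contains:
  assumes "P \<in> P1 D" "wasserstein1 D P (empirical D N \<omega>) \<le> ennreal \<theta>"
  shows "P \<in> ambiguity_set D N \<theta> \<omega>"
  using assms by (simp add: ambiguity_set_def)

text \<open>\<open>P\<close> is one of the competitors in the worst-case infimum, so the infimum is
  at most its value at \<open>P\<close>.\<close>

lemma drccp_feasible_subset_ccp_feasible:
  assumes "P \<in> ambiguity_set D N \<theta> \<omega>"
  shows "drccp_feasible D X F \<alpha> N \<theta> \<omega> \<subseteq> ccp_feasible X F \<alpha> P"
proof -
  \<comment> \<open>This infimum is real-valued, so it is a lower bound only for a set bounded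
    below; here 0 bounds all probabilities.\<close>
  have "(INF Q\<in>ambiguity_set D N \<theta> \<omega>. \<P>(\<xi> in Q. F x \<xi> \<le> 0)) \<le> \<P>(\<xi> in P. F x \<xi> \<le> 0)" for x
    using assms by (intro cINF_lower bdd_belowI[of _ 0]) auto
  then show ?thesis
    by (auto simp: drccp_feasible_def ccp_feasible_def intro: order_trans)
qed

text \<open>
  Both \<open>P\<close> and a member \<open>Q\<close> of the ambiguity set are compared with the empirical measure, so no
  triangle inequality for \<open>wasserstein1\<close> (which would require gluing couplings) is needed.
\<close>

lemma eventually_drccp_feasible:
  assumes P: "P \<in> P1 D"
    and x: "x \<in> X"
    and H: "{\<xi>\<in>mspace D. F x \<xi> \<le> 0} \<in> sets (metric_borel D)"
    and U: "openin (mtopology_of D) U" "U \<subseteq> {\<xi>\<in>mspace D. F x \<xi> \<le> 0}" "measure P U > 1 - \<alpha>"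
    and \<epsilon>: "\<epsilon> \<longlonglongrightarrow> 0" "\<forall>\<^sub>F N in sequentially. 0 \<le> \<epsilon> N"
    and W: "\<forall>\<^sub>F N in sequentially. wasserstein1 D P (empirical D N \<omega>) \<le> ennreal (\<epsilon> N)"
  shows "\<forall>\<^sub>F N in sequentially. x \<in> drccp_feasible D X F \<alpha> N (\<epsilon> N) \<omega>"
proof -
  interpret P: prob_space P by (rule P1_D[OF P])
  have erosion_sets [simp]: "erosion D U \<delta> \<in> sets (metric_borel D)" for \<delta>
    by (intro closedin_imp_sets_metric_borel closedin_erosion)
  have U_sets: "U \<in> sets (metric_borel D)"
    using U(1) by (rule openin_imp_sets_metric_borel)
  \<comment> \<open>Continuity from below along the erosions finds a radius at which the eroded set
    still has mass above \<open>1 - \<alpha>\<close>.\<close>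
  have "(\<lambda>n. measure P (erosion D U (inverse (Suc n)))) \<longlonglongrightarrow> measure P (\<Union>n. erosion D U (inverse (Suc n)))"
  proof (rule P.finite_Lim_measure_incseq)
    show "range (\<lambda>n. erosion D U (inverse (Suc n))) \<subseteq> sets P"
      by (auto simp: P1_D(2)[OF P])
    show "incseq (\<lambda>n. erosion D U (inverse (Suc n)))"
      by (intro monoI erosion_antimono) (simp add: field_simps)
  qed
  then have "(\<lambda>n. measure P (erosion D U (inverse (Suc n)))) \<longlonglongrightarrow> measure P U"
    unfolding UN_erosion[OF U(1)] .
  then have "\<forall>\<^sub>F n in sequentially. measure P (erosion D U (inverse (Suc n))) > 1 - \<alpha>"
    using U(3) by (rule order_tendstoD)
  then obtain n where n: "measure P (erosion D U (inverse (Suc n))) > 1 - \<alpha>"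
    by (auto simp: eventually_sequentially)
  \<comment> \<open>Half the radius, since the margin is used twice: from \<open>P\<close> to the
    empirical measure, and from there to \<open>Q\<close>.\<close>
  define \<delta> :: real where "\<delta> = inverse (Suc n) / 2"
  have "\<delta> > 0" by (simp add: \<delta>_def)
  define gap where "gap = measure P (erosion D U (\<delta> + \<delta>)) - (1 - \<alpha>)"
  have "gap > 0" using n by (simp add: gap_def \<delta>_def)
  \<comment> \<open>Two transports lose mass at most \<open>2 * \<epsilon> N / \<delta>\<close>,
    which this bound keeps below \<open>gap\<close>.\<close>
  have "\<forall>\<^sub>F N in sequentially. \<epsilon> N < \<delta> * gap / 2"
    using \<open>\<delta> > 0\<close> \<open>gap > 0\<close> by (intro order_tendstoD(2)[OF \<epsilon>(1)]) simp
  then show ?thesis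
    using \<epsilon>(2) W
  proof eventually_elim
    case (elim N)
    let ?E = "empirical D N \<omega>"
    have "1 - \<alpha> \<le> \<P>(\<xi> in Q. F x \<xi> \<le> 0)" if Q: "Q \<in> ambiguity_set D N (\<epsilon> N) \<omega>" for Q
    proof -
      have Q1: "Q \<in> P1 D" and WQ: "wasserstein1 D Q ?E \<le> ennreal (\<epsilon> N)"
        using Q by (auto simp: ambiguity_set_def)
      interpret Q: prob_space Q by (rule P1_D[OF Q1])
      have "ennreal \<delta> * emeasure P (erosion D U (\<delta> + \<delta>))
              \<le> ennreal \<delta> * emeasure ?E (erosion D U \<delta>) + ennreal (\<epsilon> N)"
        by (rule wasserstein1_transport_le(1)[OF erosion_sets erosion_sets erosion_add_near elim(3)])
      \<comment> \<open>The empirical measure is the second argument of the distance in both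
        comparisons, so this one uses the reverse transport inequality.\<close>
      also have "ennreal \<delta> * emeasure ?E (erosion D U \<delta>)
              \<le> ennreal \<delta> * emeasure Q U + ennreal (\<epsilon> N)"
        by (rule wasserstein1_transport_le(2)[OF erosion_sets U_sets _ WQ]) (auto simp: erosion_def)
      finally have "ennreal (\<delta> * measure P (erosion D U (\<delta> + \<delta>)))
              \<le> ennreal (\<delta> * measure Q U + 2 * \<epsilon> N)"
        using \<open>\<delta> > 0\<close> elim(2)
        by (simp add: P.emeasure_eq_measure Q.emeasure_eq_measure ennreal_mult add.assoc
            mult_2[of "ennreal (\<epsilon> N)"])
      then have "\<delta> * measure P (erosion D U (\<delta> + \<delta>)) \<le> \<delta> * measure Q U + 2 * \<epsilon> N"
        using \<open>\<delta> > 0\<close> elim(2) by (subst (asm) ennreal_le_iff) auto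
      then have "\<delta> * (1 - \<alpha>) \<le> \<delta> * measure Q U"
        using elim(1) by (simp add: gap_def algebra_simps)
      then have "1 - \<alpha> \<le> measure Q U"
        using \<open>\<delta> > 0\<close> by simp
      also have "\<dots> \<le> measure Q {\<xi>\<in>mspace D. F x \<xi> \<le> 0}"
        using U(2) H by (intro Q.finite_measure_mono) (auto simp: P1_D(2)[OF Q1])
      finally show ?thesis
        by (simp add: P1_D(3)[OF Q1])
    qed
    \<comment> \<open>A real infimum over the empty set carries no lower bound; membership of
      \<open>P\<close> excludes this case.\<close>
    moreover have "ambiguity_set D N (\<epsilon> N) \<omega> \<noteq> {}"
      using ambiguity_set_contains[OF P elim(3)] by blast
    ultimately show ?case
      using x by (auto simp: drccp_feasible_def intro: cINF_greatest)
  qed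
qed

section \<open>Almost sure concentration of the empirical measure\<close>

lemma empirical_cong: "(\<And>i. i \<in> {1..N} \<Longrightarrow> \<omega> i = \<omega>' i) \<Longrightarrow> empirical D N \<omega> = empirical D N \<omega>'"
  by (simp add: empirical_def)

text \<open>First Borel-Cantelli lemma: the failure events have summable probabilities once the
  bounds on finite products are transferred to the infinite product by restriction to the first
  \<open>N\<close> coordinates.\<close>

lemma AE_eventually_wasserstein1_le:
  fixes \<beta> \<epsilon> :: "nat \<Rightarrow> real"
  assumes prob_P: "prob_space P"
    and \<beta>: "\<And>N. N \<ge> 1 \<Longrightarrow> \<beta> N < 1" "summable \<beta>"
    and concentration:
      "\<And>N. N \<ge> 1 \<Longrightarrow>
         \<P>(\<omega> in PiM {1..N} (\<lambda>_. P). wasserstein1 D P (empirical D N \<omega>) \<le> ennreal (\<epsilon> N)) \<ge> 1 - \<beta> N"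
  shows "AE \<omega> in PiM {1..} (\<lambda>_. P).
           \<forall>\<^sub>F N in sequentially. wasserstein1 D P (empirical D N \<omega>) \<le> ennreal (\<epsilon> N)"
proof -
  interpret prob_space P by fact
  interpret product_prob_space "\<lambda>_::nat. P" "{1..}"
    by (rule product_prob_spaceI) (rule prob_P)
  let ?M = "PiM {1..} (\<lambda>_::nat. P)" and ?MN = "\<lambda>N. PiM {1..N::nat} (\<lambda>_. P)"
  let ?good = "\<lambda>N \<omega>. wasserstein1 D P (empirical D N \<omega>) \<le> ennreal (\<epsilon> N)"
  define G where "G N = {\<omega>\<in>space (?MN N). ?good N \<omega>}" for N
  \<comment> \<open>The conjunct \<open>N \<ge> 1\<close> makes \<open>B 0\<close> empty, since the
    concentration bounds start at 1.\<close>
  define B where "B N = {\<omega>\<in>space ?M. N \<ge> 1 \<and> \<not> ?good N \<omega>}" for N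
  have G: "G N \<in> sets (?MN N)" "measure (?MN N) (G N) \<ge> 1 - \<beta> N" if "N \<ge> 1" for N
  proof -
    show "measure (?MN N) (G N) \<ge> 1 - \<beta> N"
      using concentration[OF that] by (simp add: G_def)
    \<comment> \<open>A set outside the sigma-algebra would have measure 0, so the concentration bound
      itself forces measurability.\<close>
    then have "measure (?MN N) (G N) \<noteq> 0"
      using \<beta>(1)[OF that] by linarith
    then show "G N \<in> sets (?MN N)"
      using measure_notin_sets by blast
  qed
  have B: "B N \<in> sets ?M" "measure ?M (B N) \<le> \<beta> N" if "N \<ge> 1" for N
  proof -
    interpret MN: prob_space "?MN N" by (intro prob_space_PiM prob_P)
    let ?r = "\<lambda>\<omega>::nat \<Rightarrow> _. restrict \<omega> {1..N}"
    have r: "?r \<in> ?M \<rightarrow>\<^sub>M ?MN N"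
      by (rule measurable_restrict_subset) auto
    have restrict_r: "empirical D N (?r \<omega>) = empirical D N \<omega>" for \<omega>
      by (rule empirical_cong) simp
    \<comment> \<open>The empirical measure reads only the coordinates in \<open>{1..N}\<close>, so
      failure is a cylinder event.\<close>
    have B_eq: "B N = ?r -` (space (?MN N) - G N) \<inter> space ?M"
      using measurable_space[OF r] that restrict_r
      by (auto simp: B_def G_def)
    show "B N \<in> sets ?M"
      unfolding B_eq by (intro measurable_sets[OF r] sets.compl_sets G(1)[OF that])
    have "measure ?M (B N) = measure (distr ?M (?MN N) ?r) (space (?MN N) - G N)"
      unfolding B_eq using r G(1)[OF that] by (subst measure_distr) auto
    also have "distr ?M (?MN N) ?r = ?MN N"
      by (rule distr_PiM_restrict_finite) auto
    also have "measure (?MN N) (space (?MN N) - G N) \<le> \<beta> N"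
      using G[OF that] MN.prob_compl[of "G N"] by simp
    finally show "measure ?M (B N) \<le> \<beta> N" .
  qed
  have B_sets: "B N \<in> sets ?M" for N
    using B(1)[of N] by (cases "N \<ge> 1") (auto simp: B_def)
  have "summable (\<lambda>N. measure ?M (B N))"
    using B(2) by (intro summable_comparison_test'[OF \<beta>(2), of 1]) simp
  moreover have "emeasure ?M (B N) < \<infinity>" for N
    by (simp add: P.emeasure_eq_measure del: One_nat_def)
  ultimately have "AE \<omega> in ?M. \<forall>\<^sub>F N in sequentially. \<omega> \<in> space ?M - B N"
    using B_sets by (intro borel_cantelli_AE1)
  then show ?thesis
  proof (rule AE_mp, intro AE_I2 impI)
    fix \<omega> assume "\<forall>\<^sub>F N in sequentially. \<omega> \<in> space ?M - B N"
    with eventually_ge_at_top[of 1] show "\<forall>\<^sub>F N in sequentially. ?good N \<omega>"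
      by eventually_elim (auto simp: B_def)
  qed
qed

section \<open>Convergence of optimal values and optimizers\<close>

lemma opt_value_eq:
  assumes "x \<in> optimizers c S"
  shows "opt_value c S = ereal (c \<bullet> x)"
  unfolding opt_value_def
  using assms by (intro INF_eqI) (auto simp: optimizers_def is_arg_min_linorder)

lemma opt_value_antimono: "S \<subseteq> T \<Longrightarrow> opt_value c T \<le> opt_value c S"
  unfolding opt_value_def by (rule INF_superset_mono) auto

text \<open>A squeeze: the inclusion in \<open>S\<close> bounds the values from below, and points of
  \<open>T\<close> near the optimizer, each eventually feasible, bound them from above. Each upper
  level needs just one such point.\<close>

lemma opt_value_tendsto:
  fixes c :: "'b::real_inner"
  assumes x: "x \<in> optimizers c S" "x \<in> closure T"
    and inner: "\<And>z. z \<in> T \<Longrightarrow> \<forall>\<^sub>F N in sequentially. z \<in> S' N"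
    and outer: "\<forall>\<^sub>F N in sequentially. S' N \<subseteq> S"
  shows "(\<lambda>N. opt_value c (S' N)) \<longlonglongrightarrow> opt_value c S"
proof (rule order_tendstoI)
  fix a assume "a < opt_value c S"
  then show "\<forall>\<^sub>F N in sequentially. a < opt_value c (S' N)"
    using outer by (auto elim!: eventually_mono intro: less_le_trans opt_value_antimono)
next
  fix a assume a: "opt_value c S < a"
  \<comment> \<open>A real threshold, also when \<open>a\<close> is infinite; the half-space below
    it is an open neighbourhood of \<open>x\<close> and so meets \<open>T\<close>.\<close>
  then obtain r where r: "c \<bullet> x < r" "ereal r < a"
    using opt_value_eq[OF x(1)] ereal_dense2[of "ereal (c \<bullet> x)" a] by auto
  have "open {z. c \<bullet> z < r}"
    by (intro open_Collect_less continuous_intros)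
  then obtain z where z: "z \<in> T" "c \<bullet> z < r"
    using x(2) r(1) by (auto simp: closure_iff_nhds_not_empty)
  from inner[OF z(1)] show "\<forall>\<^sub>F N in sequentially. opt_value c (S' N) < a"
  proof eventually_elim
    case (elim N)
    then have "opt_value c (S' N) \<le> ereal (c \<bullet> z)"
      unfolding opt_value_def by (rule INF_lower)
    also have "\<dots> < ereal r" using z by simp
    finally show ?case using r by simp
  qed
qed

text \<open>Closedness of \<open>S\<close> keeps the limit feasible, and continuity of the cost
  identifies its cost with the limit of the optimal values.\<close>

lemma accumulation_point_optimizer:
  fixes c :: "'b::real_inner"
  assumes S: "closed S" and x0: "x0 \<in> optimizers c S"
    and outer: "\<forall>\<^sub>F N in sequentially. S' N \<subseteq> S"
    and vals: "(\<lambda>N. opt_value c (S' N)) \<longlonglongrightarrow> opt_value c S"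
    and x: "\<forall>\<^sub>F N in sequentially. x N \<in> optimizers c (S' N)"
    and r: "strict_mono r" "(x \<circ> r) \<longlonglongrightarrow> y"
  shows "y \<in> optimizers c S"
proof -
  have "\<forall>\<^sub>F N in sequentially. x N \<in> S"
    using x outer by eventually_elim (auto simp: optimizers_def is_arg_min_linorder)
  then have "\<forall>\<^sub>F k in sequentially. (x \<circ> r) k \<in> S"
    unfolding o_def by (rule eventually_subseq[OF r(1)])
  then have "y \<in> S"
    using S r(2) by (intro Lim_in_closed_set) auto
  \<comment> \<open>Since \<open>x0\<close> attains the value, the limit is finite and convergence
    can be transferred from \<open>ereal\<close> to the reals.\<close>
  have "(\<lambda>k. opt_value c (S' (r k))) \<longlonglongrightarrow> ereal (c \<bullet> x0)"
    using LIMSEQ_subseq_LIMSEQ[OF vals r(1)] opt_value_eq[OF x0] by (simp add: o_def)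
  moreover have "\<forall>\<^sub>F k in sequentially. opt_value c (S' (r k)) = ereal (c \<bullet> x (r k))"
    using eventually_subseq[OF r(1) x] by eventually_elim (rule opt_value_eq)
  ultimately have "(\<lambda>k. ereal (c \<bullet> x (r k))) \<longlonglongrightarrow> ereal (c \<bullet> x0)"
    by (rule Lim_transform_eventually)
  then have lim_x0: "(\<lambda>k. c \<bullet> x (r k)) \<longlonglongrightarrow> c \<bullet> x0" by simp
  have "(\<lambda>k. c \<bullet> x (r k)) \<longlonglongrightarrow> c \<bullet> y"
    using r(2) by (auto simp: o_def intro!: tendsto_intros)
  from this lim_x0 have "c \<bullet> y = c \<bullet> x0"
    by (rule LIMSEQ_unique)
  with \<open>y \<in> S\<close> x0 show ?thesis
    by (auto simp: optimizers_def is_arg_min_linorder)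
qed

section \<open>Continuity of \<open>F\<close> and closedness of the CCP-feasible set\<close>

text \<open>Pairs sharing \<open>\<xi>\<close> are exactly as far apart as their first components,
  so a single modulus serves all \<open>\<xi>\<close> at once.\<close>

lemma uniformly_continuous_fst:
  fixes F :: "'b::metric_space \<Rightarrow> 'a \<Rightarrow> real"
  assumes "uniformly_continuous_map (prod_metric euclidean_metric D) euclidean_metric
             (\<lambda>(x, \<xi>). F x \<xi>)" and "\<eta> > 0"
  obtains \<delta> where "\<delta> > 0"
    "\<And>x y \<xi>. \<xi> \<in> mspace D \<Longrightarrow> dist y x < \<delta> \<Longrightarrow> dist (F y \<xi>) (F x \<xi>) < \<eta>"
proof -
  obtain \<delta> where "\<delta> > 0" and \<delta>:
    "\<forall>p \<in> mspace (prod_metric euclidean_metric D). \<forall>q \<in> mspace (prod_metric euclidean_metric D).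
       mdist (prod_metric euclidean_metric D) q p < \<delta>
         \<longrightarrow> mdist euclidean_metric ((\<lambda>(x, \<xi>). F x \<xi>) q) ((\<lambda>(x, \<xi>). F x \<xi>) p) < \<eta>"
    using assms unfolding uniformly_continuous_map_def by blast
  have "dist (F y \<xi>) (F x \<xi>) < \<eta>" if "\<xi> \<in> mspace D" "dist y x < \<delta>" for x y \<xi>
    using \<delta>[rule_format, of "(x, \<xi>)" "(y, \<xi>)"] that
    by (simp add: prod_dist_def mdist_self)
  with \<open>\<delta> > 0\<close> show ?thesis by (rule that)
qed

lemma uniformly_continuous_imp_continuous_snd:
  assumes "uniformly_continuous_map (prod_metric euclidean_metric D) euclidean_metric
             (\<lambda>(x, \<xi>). F x \<xi>)"
  shows "continuous_map (mtopology_of D) euclidean (F x)"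
proof -
  have "uniformly_continuous_map D (prod_metric euclidean_metric D) (\<lambda>\<xi>. (x, \<xi>))"
    by (auto simp: uniformly_continuous_map_def prod_dist_def)
  from uniformly_continuous_map_compose[OF this assms]
  have "uniformly_continuous_map D euclidean_metric (F x)"
    by (simp add: o_def)
  from uniformly_continuous_imp_continuous_map[OF this] show ?thesis by simp
qed

text \<open>For \<open>x n\<close> close to \<open>y\<close>, the constraint set of
  \<open>x n\<close> lies in the relaxed set \<open>F y \<xi> \<le> \<eta>\<close>. Each relaxed set
  thus has mass at least \<open>1 - \<alpha>\<close>, and continuity from above removes the
  relaxation.\<close>

lemma closed_ccp_feasible:
  fixes F :: "'b::metric_space \<Rightarrow> 'a \<Rightarrow> real"
  assumes F: "uniformly_continuous_map (prod_metric euclidean_metric D) euclidean_metric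
                (\<lambda>(x, \<xi>). F x \<xi>)"
    and P: "P \<in> P1 D" and X: "closed X"
  shows "closed (ccp_feasible X F \<alpha> P)"
  unfolding closed_sequential_limits
proof (intro allI impI, elim conjE)
  interpret prob_space P by (rule P1_D[OF P])
  fix x y assume x: "\<forall>n. x n \<in> ccp_feasible X F \<alpha> P" and lim: "x \<longlonglongrightarrow> y"
  let ?A = "\<lambda>\<eta>. {\<xi>\<in>mspace D. F y \<xi> \<le> \<eta>}"
  have A_sets: "?A \<eta> \<in> sets P" for \<eta>
  proof -
    have "closedin (mtopology_of D) {\<xi> \<in> topspace (mtopology_of D). F y \<xi> \<in> {..\<eta>}}"
      by (rule closedin_continuous_map_preimage[OF uniformly_continuous_imp_continuous_snd[OF F]])
        simp
    then show ?thesis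
      by (simp add: P1_D(2)[OF P] closedin_imp_sets_metric_borel)
  qed
  have ge: "1 - \<alpha> \<le> measure P (?A \<eta>)" if "\<eta> > 0" for \<eta>
  proof -
    obtain \<delta> where \<delta>: "\<delta> > 0"
      "\<And>x y \<xi>. \<xi> \<in> mspace D \<Longrightarrow> dist y x < \<delta> \<Longrightarrow> dist (F y \<xi>) (F x \<xi>) < \<eta>"
      using uniformly_continuous_fst[OF F \<open>\<eta> > 0\<close>] by blast
    obtain n where n: "dist (x n) y < \<delta>"
      using tendstoD[OF lim \<delta>(1)] by (auto simp: eventually_sequentially)
    have "1 - \<alpha> \<le> measure P {\<xi>\<in>mspace D. F (x n) \<xi> \<le> 0}"
      using x by (auto simp: ccp_feasible_def P1_D(3)[OF P])
    also have "\<dots> \<le> measure P (?A \<eta>)"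
    proof (rule finite_measure_mono[OF _ A_sets], safe)
      fix \<xi> assume "\<xi> \<in> mspace D" "F (x n) \<xi> \<le> 0"
      with \<delta>(2)[OF _ n, of \<xi>] show "F y \<xi> \<le> \<eta>" by (auto simp: dist_real_def)
    qed
    finally show ?thesis .
  qed
  have "(\<lambda>n. measure P (?A (inverse (Suc n)))) \<longlonglongrightarrow> measure P (\<Inter>n. ?A (inverse (Suc n)))"
  proof (rule finite_Lim_measure_decseq)
    show "range (\<lambda>n. ?A (inverse (Suc n))) \<subseteq> sets P"
      using A_sets by blast
    show "decseq (\<lambda>n. ?A (inverse (Suc n)))"
    proof (intro antimonoI subsetI)
      fix m n :: nat and \<xi> assume "m \<le> n" "\<xi> \<in> ?A (inverse (Suc n))"
      then have "F y \<xi> \<le> inverse (real (Suc n))" by simp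
      also have "\<dots> \<le> inverse (real (Suc m))"
        using \<open>m \<le> n\<close> by (intro le_imp_inverse_le) auto
      finally show "\<xi> \<in> ?A (inverse (Suc m))"
        using \<open>\<xi> \<in> ?A _\<close> by simp
    qed
  qed
  moreover have "(\<Inter>n. ?A (inverse (Suc n))) = ?A 0"
  proof (intro set_eqI iffI)
    fix \<xi> assume "\<xi> \<in> (\<Inter>n. ?A (inverse (Suc n)))"
    then have \<xi>: "\<xi> \<in> mspace D" and le: "F y \<xi> \<le> inverse (Suc n)" for n
      by auto
    have "F y \<xi> \<le> 0"
    proof (rule ccontr)
      assume "\<not> F y \<xi> \<le> 0"
      then obtain n where "inverse (Suc n) < F y \<xi>"
        using reals_Archimedean[of "F y \<xi>"] by (auto simp: not_le)
      with le[of n] show False by linarith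
    qed
    with \<xi> show "\<xi> \<in> ?A 0" by simp
  next
    fix \<xi> assume "\<xi> \<in> ?A 0"
    then show "\<xi> \<in> (\<Inter>n. ?A (inverse (Suc n)))"
      by (auto intro: order_trans)
  qed
  ultimately have "(\<lambda>n. measure P (?A (inverse (Suc n)))) \<longlonglongrightarrow> measure P (?A 0)"
    by simp
  then have "1 - \<alpha> \<le> measure P (?A 0)"
    by (rule LIMSEQ_le_const) (auto intro!: exI[of _ 0] ge simp del: of_nat_Suc)
  moreover have "y \<in> X"
    using X x lim by (auto simp: closed_sequential_limits ccp_feasible_def)
  ultimately show "y \<in> ccp_feasible X F \<alpha> P"
    by (simp add: ccp_feasible_def P1_D(3)[OF P])
qed

section \<open>Open inner approximation of the constraint set and almost sure convergence\<close>

text \<open>Subadditivity. It is applied with \<open>B\<close> an open part of the constraint set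
  and \<open>N\<close> its zero level set or its frontier.\<close>

lemma (in finite_measure) measure_le_if_subset_Un_null:
  assumes "A \<subseteq> B \<union> N" "B \<in> sets M" "N \<in> sets M" "measure M N = 0"
  shows "measure M A \<le> measure M B"
proof -
  have "measure M A \<le> measure M (B \<union> N)"
    using assms by (intro finite_measure_mono) auto
  also have "\<dots> \<le> measure M B + measure M N"
    using assms by (intro measure_Un_le) auto
  finally show ?thesis using assms by simp
qed

theorem mainTheorem2:
  fixes D :: "(real ^ 'm) metric"
    and X Y :: "(real ^ 'n) set"
    and c :: "real ^ 'n"
    and \<alpha> :: real
    and P :: "(real ^ 'm) measure"
    and \<beta> \<epsilon> :: "nat \<Rightarrow> real"
    and F :: "real ^ 'n \<Rightarrow> real ^ 'm \<Rightarrow> real"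
    and H :: "real ^ 'n \<Rightarrow> (real ^ 'm) set"
  defines "H \<equiv> \<lambda>x. {\<xi>\<in>mspace D. F x \<xi> \<le> 0}"
  assumes complete_D: "mcomplete_of D"
    and X: "closed X" "convex X"
    and \<alpha>: "0 < \<alpha>" "\<alpha> < 1"
    and P: "P \<in> P1 D"
    and \<beta>: "\<And>N. N \<ge> 1 \<Longrightarrow> 0 < \<beta> N \<and> \<beta> N < 1" "summable \<beta>"
    and \<epsilon>: "\<And>N. N \<ge> 1 \<Longrightarrow> 0 < \<epsilon> N" "\<epsilon> \<longlonglongrightarrow> 0"
    and concentration:
      "\<And>N. N \<ge> 1 \<Longrightarrow>
         \<P>(\<omega> in PiM {1..N} (\<lambda>_. P). wasserstein1 D P (empirical D N \<omega>) \<le> ennreal (\<epsilon> N)) \<ge> 1 - \<beta> N"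
    and F: "uniformly_continuous_map (prod_metric euclidean_metric D) euclidean_metric
              (\<lambda>(x, \<xi>). F x \<xi>)"
    and regularity:
      "(\<forall>x\<in>X. \<P>(\<xi> in P. F x \<xi> = 0) = 0) \<or>
       ((\<forall>x\<in>X. convex (H x)) \<and>
        inner_semicontinuous_on X D H \<and> outer_semicontinuous_on X D H \<and>
        (\<forall>x\<in>X. measure P (mtopology_of D frontier_of H x) = 0))"
    and Y: "compact Y" "Y \<subseteq> X"
    and optimizers_CCP: "optimizers c (ccp_feasible X F \<alpha> P) \<subseteq> Y"
    and strictly_feasible_optimizer:
      "\<exists>x\<in>optimizers c (ccp_feasible X F \<alpha> P).
         x \<in> closure {x\<in>X. \<P>(\<xi> in P. F x \<xi> \<le> 0) > 1 - \<alpha>}"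
    and optimizers_DRCCP:
      "\<forall>\<^sub>F N in sequentially. \<forall>\<omega>\<in>{1..N} \<rightarrow> mspace D.
         optimizers c (drccp_feasible D X F \<alpha> N (\<epsilon> N) \<omega>) \<subseteq> Y"
  shows "AE \<omega> in PiM {1..} (\<lambda>_. P).
    (\<forall>\<^sub>F N in sequentially.
       opt_value c (ccp_feasible X F \<alpha> P)
         \<le> opt_value c (drccp_feasible D X F \<alpha> N (\<epsilon> N) \<omega>)) \<and>
    (\<lambda>N. opt_value c (drccp_feasible D X F \<alpha> N (\<epsilon> N) \<omega>))
       \<longlonglongrightarrow> opt_value c (ccp_feasible X F \<alpha> P) \<and>
    (\<forall>x y. (\<forall>\<^sub>F N in sequentially. x N \<in> optimizers c (drccp_feasible D X F \<alpha> N (\<epsilon> N) \<omega>)) \<and>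
           (\<exists>r. strict_mono r \<and> (x \<circ> r) \<longlonglongrightarrow> y)
       \<longrightarrow> y \<in> optimizers c (ccp_feasible X F \<alpha> P))"
proof -
  interpret P: prob_space P by (rule P1_D[OF P])
  let ?S = "ccp_feasible X F \<alpha> P"
  let ?T = "{x\<in>X. \<P>(\<xi> in P. F x \<xi> \<le> 0) > 1 - \<alpha>}"
  let ?S' = "\<lambda>\<omega> N. drccp_feasible D X F \<alpha> N (\<epsilon> N) \<omega>"
  let ?good = "\<lambda>\<omega>. \<forall>\<^sub>F N in sequentially. wasserstein1 D P (empirical D N \<omega>) \<le> ennreal (\<epsilon> N)"
  have contF: "continuous_map (mtopology_of D) euclidean (F x)" for x
    by (rule uniformly_continuous_imp_continuous_snd[OF F])
  have closed_pre: "closedin (mtopology_of D) {\<xi>\<in>mspace D. F x \<xi> \<in> C}" if "closed C" for x C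
    using closedin_continuous_map_preimage[OF contF, of C x] that by simp
  have H_closed: "closedin (mtopology_of D) (H x)" for x
    using closed_pre[of "{..0}" x] by (simp add: H_def)
  obtain x0 where x0: "x0 \<in> optimizers c ?S" "x0 \<in> closure ?T"
    using strictly_feasible_optimizer by blast
  \<comment> \<open>Each regularity alternative supplies an open subset of full mass: the strict
    sublevel set if the zero level set is null, the interior if the frontier is null.\<close>
  have open_approx: "\<exists>U. openin (mtopology_of D) U \<and> U \<subseteq> H x \<and> measure P (H x) \<le> measure P U"
    if x: "x \<in> X" for x
    using regularity
  proof (elim disjE conjE)
    let ?U = "{\<xi>\<in>mspace D. F x \<xi> < 0}" and ?Z = "{\<xi>\<in>mspace D. F x \<xi> = 0}"
    assume "\<forall>x\<in>X. \<P>(\<xi> in P. F x \<xi> = 0) = 0"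
    then have "measure P ?Z = 0"
      using x by (simp add: P1_D(3)[OF P])
    moreover have "openin (mtopology_of D) ?U"
      using openin_continuous_map_preimage[OF contF, of "{..<0}" x] by simp
    moreover have "closedin (mtopology_of D) ?Z"
      using closed_pre[of "{0}" x] by simp
    ultimately show ?thesis
      by (intro exI[of _ ?U] conjI P.measure_le_if_subset_Un_null[of _ _ ?Z])
        (auto simp: H_def P1_D(2)[OF P]
          intro: openin_imp_sets_metric_borel closedin_imp_sets_metric_borel)
  next
    let ?U = "mtopology_of D interior_of H x" and ?Z = "mtopology_of D frontier_of H x"
    assume "\<forall>x\<in>X. measure P (mtopology_of D frontier_of H x) = 0"
    then have "measure P (mtopology_of D frontier_of H x) = 0"
      using x by blast
    moreover have "H x \<subseteq> ?U \<union> ?Z"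
      using closure_of_subset[OF closedin_subset[OF H_closed[of x]]] by (auto simp: frontier_of_def)
    ultimately show ?thesis
      by (intro exI[of _ ?U] conjI P.measure_le_if_subset_Un_null[of _ _ ?Z])
        (auto simp: P1_D(2)[OF P] interior_of_subset closedin_frontier_of
          intro: openin_imp_sets_metric_borel closedin_imp_sets_metric_borel)
  qed
  have "AE \<omega> in PiM {1..} (\<lambda>_. P). ?good \<omega>"
    using \<beta> concentration by (intro AE_eventually_wasserstein1_le[of P \<beta>] P.prob_space_axioms) auto
  then show ?thesis
  \<comment> \<open>The rest is deterministic on the event \<open>?good\<close>. One null set thus
    serves all sequences of optimizers and all their accumulation points.\<close>
  proof (rule AE_mp, intro AE_I2 impI)
    fix \<omega> assume good: "?good \<omega>"
    have outer: "\<forall>\<^sub>F N in sequentially. ?S' \<omega> N \<subseteq> ?S"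
      using good
      by eventually_elim (intro drccp_feasible_subset_ccp_feasible ambiguity_set_contains P)
    have inner: "\<forall>\<^sub>F N in sequentially. x \<in> ?S' \<omega> N" if "x \<in> ?T" for x
    proof -
      have x: "x \<in> X" and gt: "measure P (H x) > 1 - \<alpha>"
        using that by (auto simp: H_def P1_D(3)[OF P])
      obtain U where U: "openin (mtopology_of D) U" "U \<subseteq> H x" "measure P (H x) \<le> measure P U"
        using open_approx[OF x] by blast
      have "\<forall>\<^sub>F N in sequentially. 0 \<le> \<epsilon> N"
        using \<epsilon>(1) by (auto simp: eventually_sequentially intro!: exI[of _ 1] less_imp_le)
      then show ?thesis
        using P x U gt \<epsilon>(2) good closedin_imp_sets_metric_borel[OF H_closed[of x]]
        by (intro eventually_drccp_feasible[where U = U]) (auto simp: H_def)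
    qed
    have tendsto: "(\<lambda>N. opt_value c (?S' \<omega> N)) \<longlonglongrightarrow> opt_value c ?S"
      using x0 inner outer by (rule opt_value_tendsto)
    show "(\<forall>\<^sub>F N in sequentially. opt_value c ?S \<le> opt_value c (?S' \<omega> N)) \<and>
        (\<lambda>N. opt_value c (?S' \<omega> N)) \<longlonglongrightarrow> opt_value c ?S \<and>
        (\<forall>x y. (\<forall>\<^sub>F N in sequentially. x N \<in> optimizers c (?S' \<omega> N)) \<and>
               (\<exists>r. strict_mono r \<and> (x \<circ> r) \<longlonglongrightarrow> y) \<longrightarrow> y \<in> optimizers c ?S)"
      \<comment> \<open>Claim (i) follows from \<open>outer\<close>, as an infimum over a smaller
        set is larger.\<close>
      using outer tendsto
        accumulation_point_optimizer[OF closed_ccp_feasible[OF F P X(1)] x0(1) outer tendsto]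
      by (auto elim!: eventually_mono intro: opt_value_antimono)
  qed
qed

end
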